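(* Let $A,B\subset\mathbb R^d$ be finite with $\dim[B]=d$ and $B\subset A\subset[B]$, let $k\ge 1$ be an integer, and let $\mathcal T$ be a shellable triangulation of $B$ with $h$-vector $(h_0,\dots,h_d)$. Then $$|A+kB|\ge {d+k\choose k}|A|-k{d+k\choose k+1}+\sum_{j=2}^{\min(d,k+1)}h_j{d+k+1-j\choose k+1-j}.$$
   Context: $[X]$ denotes the convex hull of $X$; $kB=B+\dots+B$ ($k$ summands, Minkowski sum). A triangulation of a finite $d$-dimensional set $B\subset\mathbb R^d$ is a geometric simplicial complex whose vertex set is exactly $B$ and whose underlying space is $[B]$; it is identified with its list of $d$-simplices. An ordering $S_1,\dots,S_m$ of the $d$-simplices of a triangulation is a shelling if for every $i\ge2$ the intersection of $S_i$ with $S_1\cup\dots\cup S_{i-1}$ is a union of facets of $S_i$; a triangulation is shellable if it admits a shelling. The index of $S_i$ is the number of facets of $S_i$ contained in $S_1\cup\dots\cup S_{i-1}$ (so $S_1$ has index $0$). The $h$-vector $(h_0,\dots,h_d)$ of a shellable triangulation is defined by letting $h_i$ be the number of simplices of index $i$ in a shelling (it does not depend on the shelling). *)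

theory Defs
  imports "HOL-Analysis.Analysis"
begin

definition triangulation_of :: "'a::euclidean_space set \<Rightarrow> 'a set set \<Rightarrow> bool"
  where "triangulation_of B \<T> \<longleftrightarrow>
    simplicial_complex \<T> \<and> {v. {v} \<in> \<T>} = B \<and> \<Union>\<T> = convex hull B"

definition full_simplices :: "'a::euclidean_space set set \<Rightarrow> 'a set set"
  where "full_simplices \<T> = {S \<in> \<T>. int DIM('a) simplex S}"

text \<open>Positions in the list are counted from 0. The union of facets is required to be nonempty,
  i.e. every simplex after the first one is attached along at least one facet; otherwise the
  h-vector would depend on the shelling (take three consecutive segments on a line, the
  middle one last).\<close>

definition shelling :: "'a::euclidean_space set set \<Rightarrow> 'a set list \<Rightarrow> bool"
  where "shelling \<T> Ss \<longleftrightarrow>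
    distinct Ss \<and> set Ss = full_simplices \<T> \<and>
    (\<forall>i. 1 \<le> i \<and> i < length Ss \<longrightarrow>
      (\<exists>\<F>. \<F> \<noteq> {} \<and> (\<forall>F\<in>\<F>. F facet_of Ss ! i) \<and>
           Ss ! i \<inter> \<Union>(set (take i Ss)) = \<Union>\<F>))"

definition shellable :: "'a::euclidean_space set set \<Rightarrow> bool"
  where "shellable \<T> \<longleftrightarrow> (\<exists>Ss. shelling \<T> Ss)"

definition shelling_index :: "'a::euclidean_space set list \<Rightarrow> nat \<Rightarrow> nat"
  where "shelling_index Ss i = card {F. F facet_of Ss ! i \<and> F \<subseteq> \<Union>(set (take i Ss))}"

text \<open>The h-vector is a relation, so that a statement about all \<open>h\<close> with
  \<open>is_h_vector \<T> h\<close> holds for whichever shelling is used to compute it.\<close>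

definition is_h_vector :: "'a::euclidean_space set set \<Rightarrow> (nat \<Rightarrow> nat) \<Rightarrow> bool"
  where "is_h_vector \<T> h \<longleftrightarrow>
    (\<exists>Ss. shelling \<T> Ss \<and>
      (\<forall>j\<le>DIM('a). h j = card {i. i < length Ss \<and> shelling_index Ss i = j}))"

end

theory Submission
  imports Defs "HOL-Library.Multiset"
begin

text \<open>
  Let \<open>S\<^sub>1, \<dots>, S\<^sub>m\<close> be a shelling and \<open>D\<^sub>i\<close> the part of \<open>S\<^sub>i\<close> outside the earlier simplices, i.e. \<open>S\<^sub>i\<close>
  without the facets opposite to a set \<open>J\<^sub>i\<close> of vertices, where \<open>|J\<^sub>i|\<close> is the index of \<open>S\<^sub>i\<close>. The dilates
  \<open>(k + 1) D\<^sub>i\<close> are disjoint, so it suffices to find enough points of \<open>A + kB\<close> in each of them.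
  In barycentric coordinates, a point \<open>a \<in> A - B\<close> in \<open>D\<^sub>i\<close> has all coordinates in \<open>[0, 1)\<close>; it is therefore
  recovered from the fractional parts of any sum of \<open>a\<close> and \<open>k\<close> vertices of \<open>S\<^sub>i\<close>, and contributes
  \<open>(d + k) choose k\<close> points. The sums of \<open>k + 1\<close> vertices that lie in \<open>(k + 1) D\<^sub>i\<close> are those that use
  every vertex in \<open>J\<^sub>i\<close>, and there are \<open>(d + k + 1 - j) choose (k + 1 - j)\<close> of them for \<open>j = |J\<^sub>i|\<close>.
  Summing over \<open>i\<close> and using \<open>h\<^sub>0 \<ge> 1\<close> and \<open>h\<^sub>1 \<ge> |B| - d - 1\<close> gives the bound.
\<close>

section \<open>Multiset sums and barycentric coordinates\<close>

text \<open>Multiplicities serve as coordinates, so a sum of vertices is a point with integral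
  coordinates whose total is the number of summands.\<close>

lemma sum_mset_eq_sum_count:
  fixes M :: "'a::real_vector multiset"
  assumes "finite V" "set_mset M \<subseteq> V"
  shows "\<Sum>\<^sub># M = (\<Sum>v\<in>V. real (count M v) *\<^sub>R v)"
  using assms(2)
proof (induction M)
  case (add x M)
  have "(\<Sum>v\<in>V. real (count (add_mset x M) v) *\<^sub>R v) =
      (\<Sum>v\<in>V. (if v = x then x else 0) + real (count M v) *\<^sub>R v)"
    by (intro sum.cong) (auto simp: scaleR_left_distrib)
  then show ?case
    using add assms(1) by (simp add: sum.distrib)
qed auto

lemma sum_count_eq_size:
  assumes "finite V" "set_mset M \<subseteq> V"
  shows "(\<Sum>v\<in>V. count M v) = size M"
  unfolding size_multiset_overloaded_eq
  by (rule sum.mono_neutral_right) (use assms in \<open>auto simp: not_in_iff\<close>)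

lemma sum_mset_in_sumset:
  fixes B :: "'a::comm_monoid_add set"
  assumes "set_mset M \<subseteq> B"
  shows "\<Sum>\<^sub># M \<in> (\<Sum>i=1..size M. B)"
  using assms
proof (induction M)
  case (add x M)
  then show ?case
    by (auto simp: add.commute[of x] intro!: set_plus_intro)
qed auto

lemma finite_sum_sets:
  fixes B :: "'a::comm_monoid_add set"
  assumes "finite B"
  shows "finite (\<Sum>i=1..n::nat. B)"
  by (induction n) (use assms in \<open>auto intro!: finite_set_plus\<close>)

text \<open>The difference of the two coefficient vectors would be an affine dependence. The common
  total is arbitrary, so this also applies to points of a dilated simplex.\<close>

lemma affine_independent_coeffs_unique:
  fixes V :: "'a::euclidean_space set"
  assumes "\<not> affine_dependent V" "(\<Sum>v\<in>V. u v *\<^sub>R v) = (\<Sum>v\<in>V. w v *\<^sub>R v)"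
    "sum u V = sum w V" "v \<in> V"
  shows "u v = w v"
proof (rule ccontr)
  assume "u v \<noteq> w v"
  have "finite V" using assms(1) aff_independent_finite by blast
  moreover have "sum (\<lambda>v. u v - w v) V = 0" "(\<Sum>v\<in>V. (u v - w v) *\<^sub>R v) = 0"
    using assms by (simp_all add: sum_subtractf scaleR_left_diff_distrib)
  moreover have "u v - w v \<noteq> 0" using \<open>u v \<noteq> w v\<close> by simp
  ultimately have "affine_dependent V"
    using assms(4) unfolding affine_dependent_explicit_finite[OF \<open>finite V\<close>]
    by (intro exI[of _ "\<lambda>v. u v - w v"]) blast
  then show False using assms(1) by simp
qed

text \<open>This turns the removal of facets from a simplex into the condition that certain
  coordinates do not vanish.\<close>

lemma mem_facet_iff_coeff_eq_0:
  fixes V :: "'a::euclidean_space set"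
  assumes "\<not> affine_dependent V" "\<And>v. v \<in> V \<Longrightarrow> 0 \<le> u v" "sum u V = 1" "j \<in> V"
  shows "(\<Sum>v\<in>V. u v *\<^sub>R v) \<in> convex hull (V - {j}) \<longleftrightarrow> u j = 0"
proof
  have fin: "finite V" using assms(1) aff_independent_finite by blast
  assume "(\<Sum>v\<in>V. u v *\<^sub>R v) \<in> convex hull (V - {j})"
  then obtain w where w: "sum w (V - {j}) = 1"
      "(\<Sum>v\<in>V-{j}. w v *\<^sub>R v) = (\<Sum>v\<in>V. u v *\<^sub>R v)"
    using fin by (auto simp: convex_hull_finite)
  let ?w = "\<lambda>v. if v = j then 0 else w v"
  have "sum ?w V = 1" "(\<Sum>v\<in>V. ?w v *\<^sub>R v) = (\<Sum>v\<in>V. u v *\<^sub>R v)"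
    using w fin assms(4) by (simp_all add: sum.remove[of V j])
  then show "u j = 0"
    using affine_independent_coeffs_unique[OF assms(1), of ?w u j] assms(3,4) by simp
next
  have fin: "finite V" using assms(1) aff_independent_finite by blast
  assume "u j = 0"
  then show "(\<Sum>v\<in>V. u v *\<^sub>R v) \<in> convex hull (V - {j})"
    using fin assms by (auto simp: convex_hull_finite sum.remove[of V j] intro!: exI[of _ u])
qed

section \<open>Points of the sumset in one dilated piece\<close>

text \<open>The two summands count disjoint families: translates of points of \<open>P\<close> by
  \<open>k\<close> vertices, and sums of \<open>k + 1\<close> vertices in which all of
  \<open>J\<close> occurs. The latter have integral coordinates, the former do not.\<close>

lemma simplex_piece_card_lower_bound:
  fixes V :: "'a::euclidean_space set"
  assumes aff: "\<not> affine_dependent V" and "J \<subseteq> V" and "V \<subseteq> B" "B \<subseteq> A" "finite A"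
    and P: "P \<subseteq> A - V" "P \<subseteq> convex hull V - (\<Union>j\<in>J. convex hull (V - {j}))"
  shows "card P * card (multisets_of_size V k) +
      (if card J \<le> k + 1 then card (multisets_of_size V (k + 1 - card J)) else 0)
    \<le> card {x \<in> A + (\<Sum>i=1..k. B).
         x /\<^sub>R real (k + 1) \<in> convex hull V - (\<Union>j\<in>J. convex hull (V - {j}))}"
    (is "_ \<le> card ?X")
proof -
  have fin: "finite V" "finite J" "finite P" "finite B"
    using aff aff_independent_finite assms finite_subset by (blast, blast, blast, blast)
  have finX: "finite ?X"
    using finite_set_plus[OF \<open>finite A\<close> finite_sum_sets[OF \<open>finite B\<close>]] by simp
  \<comment> \<open>Dividing coordinates of total \<open>k + 1\<close> by \<open>k + 1\<close> gives
    barycentric coordinates and preserves which of them vanish.\<close>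
  have memX: "(\<Sum>v\<in>V. u v *\<^sub>R v) \<in> ?X"
    if u: "\<And>v. v \<in> V \<Longrightarrow> 0 \<le> u v" "sum u V = real (k + 1)" "\<And>j. j \<in> J \<Longrightarrow> u j \<noteq> 0"
      and A: "(\<Sum>v\<in>V. u v *\<^sub>R v) \<in> A + (\<Sum>i=1..k. B)" for u
  proof -
    define w where "w v = u v / real (k + 1)" for v
    have w: "\<And>v. v \<in> V \<Longrightarrow> 0 \<le> w v" "sum w V = 1"
      using u by (simp_all add: w_def flip: sum_divide_distrib)
    have eq: "(\<Sum>v\<in>V. u v *\<^sub>R v) /\<^sub>R real (k + 1) = (\<Sum>v\<in>V. w v *\<^sub>R v)"
      by (simp add: w_def scaleR_sum_right divide_inverse mult.commute)
    have "(\<Sum>v\<in>V. w v *\<^sub>R v) \<in> convex hull V"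
      using w fin by (auto simp: convex_hull_finite)
    moreover have "(\<Sum>v\<in>V. w v *\<^sub>R v) \<notin> convex hull (V - {j})" if "j \<in> J" for j
      using mem_facet_iff_coeff_eq_0[OF aff w, of j] that u(3)[OF that] \<open>J \<subseteq> V\<close>
      by (auto simp: w_def)
    ultimately show ?thesis using A unfolding eq mem_Collect_eq by blast
  qed
  have "\<forall>a\<in>P. \<exists>u. (\<forall>v\<in>V. 0 \<le> u v) \<and> sum u V = 1 \<and> (\<Sum>v\<in>V. u v *\<^sub>R v) = a"
    using P(2) fin by (auto simp: convex_hull_finite)
  then obtain \<alpha> where \<alpha>: "\<And>a v. a \<in> P \<Longrightarrow> v \<in> V \<Longrightarrow> 0 \<le> \<alpha> a v"
      "\<And>a. a \<in> P \<Longrightarrow> sum (\<alpha> a) V = 1" "\<And>a. a \<in> P \<Longrightarrow> (\<Sum>v\<in>V. \<alpha> a v *\<^sub>R v) = a"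
    by metis
  have \<alpha>J: "\<alpha> a j \<noteq> 0" if "a \<in> P" "j \<in> J" for a j
    using mem_facet_iff_coeff_eq_0[OF aff, of "\<alpha> a" j] \<alpha>[OF that(1)] that P(2) \<open>J \<subseteq> V\<close> by auto
  \<comment> \<open>A coordinate equal to 1 would force all others to be 0 and make \<open>a\<close>
    a vertex, which \<open>P\<close> excludes.\<close>
  have \<alpha>1: "\<alpha> a v < 1" if a: "a \<in> P" and v: "v \<in> V" for a v
  proof (rule ccontr)
    assume "\<not> \<alpha> a v < 1"
    moreover have "\<alpha> a v + sum (\<alpha> a) (V - {v}) = 1"
      using \<alpha>(2)[OF a] sum.remove[OF fin(1) v, of "\<alpha> a"] by simp
    moreover have "0 \<le> sum (\<alpha> a) (V - {v})"
      using \<alpha>(1)[OF a] by (intro sum_nonneg) auto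
    ultimately have "sum (\<alpha> a) (V - {v}) = 0" "\<alpha> a v = 1" by linarith+
    then have "\<alpha> a w = 0" if "w \<in> V - {v}" for w
      using that \<alpha>(1)[OF a] fin(1) sum_nonneg_eq_0_iff[of "V - {v}" "\<alpha> a"] by auto
    then have "a = v"
      using \<alpha>(3)[OF a] sum.remove[OF fin(1) v, of "\<lambda>v. \<alpha> a v *\<^sub>R v"] \<open>\<alpha> a v = 1\<close> by simp
    then show False using a v P(1) by auto
  qed
  have size: "(\<Sum>v\<in>V. real (count M v)) = real n" if "M \<in> multisets_of_size V n" for M n
    using that sum_count_eq_size[OF fin(1), of M]
    by (auto simp: multisets_of_size_def simp flip: of_nat_sum)
  define f where "f = (\<lambda>(a::'a, M). a + \<Sum>\<^sub># M)"
  have f_eq: "f (a, M) = (\<Sum>v\<in>V. (\<alpha> a v + real (count M v)) *\<^sub>R v)"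
    if "a \<in> P" "M \<in> multisets_of_size V n" for a M n
    using that \<alpha>(3) sum_mset_eq_sum_count[OF fin(1), of M]
    by (simp add: f_def multisets_of_size_def scaleR_left_distrib sum.distrib)
  \<comment> \<open>The coordinates of a non-vertex are the fractional parts of those of its translates.\<close>
  have frac: "u = u'" "m = m'"
    if "u + real m = u' + real m'" "0 \<le> u" "u < 1" "0 \<le> u'" "u' < 1" for u u' m m'
  proof -
    have "\<lfloor>u + real m\<rfloor> = int m" "\<lfloor>u' + real m'\<rfloor> = int m'"
      using that(2-) by (simp_all add: floor_eq_iff)
    then show "m = m'" using that(1) by simp
    then show "u = u'" using that(1) by simp
  qed
  let ?Q1 = "P \<times> multisets_of_size V k"
  let ?Q2 = "{M \<in> multisets_of_size V (k + 1). J \<subseteq> set_mset M}"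
  have inj1: "inj_on f ?Q1"
  proof (rule inj_onI, clarify)
    fix a M a' M'
    assume h: "a \<in> P" "M \<in> multisets_of_size V k" "a' \<in> P" "M' \<in> multisets_of_size V k"
      "f (a, M) = f (a', M')"
    have c: "\<alpha> a v + real (count M v) = \<alpha> a' v + real (count M' v)" if "v \<in> V" for v
      by (rule affine_independent_coeffs_unique[OF aff _ _ that])
        (use h(5) in \<open>simp_all add: f_eq[OF h(1,2)] f_eq[OF h(3,4)] sum.distrib \<alpha>(2)[OF h(1)]
          \<alpha>(2)[OF h(3)] size[OF h(2)] size[OF h(4)]\<close>)
    have "\<alpha> a v = \<alpha> a' v" "count M v = count M' v" if "v \<in> V" for v
      using frac[OF c[OF that]] \<alpha>(1) \<alpha>1 h that by auto
    moreover have "count M v = count M' v" if "v \<notin> V" for v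
      using h that by (metis count_eq_zero_iff multisets_of_size_subset subsetD)
    ultimately have "(\<Sum>v\<in>V. \<alpha> a v *\<^sub>R v) = (\<Sum>v\<in>V. \<alpha> a' v *\<^sub>R v)" "M = M'"
      by (auto simp: multiset_eq_iff intro: sum.cong)
    then show "a = a' \<and> M = M'"
      using \<alpha>(3) h by simp
  qed
  have inj2: "inj_on \<Sum>\<^sub># ?Q2"
  proof (rule inj_onI)
    fix M M' assume "M \<in> ?Q2" "M' \<in> ?Q2" and eq: "\<Sum>\<^sub># M = \<Sum>\<^sub># M'"
    then have h: "M \<in> multisets_of_size V (k + 1)" "M' \<in> multisets_of_size V (k + 1)" by auto
    have "real (count M v) = real (count M' v)" if "v \<in> V" for v
      by (rule affine_independent_coeffs_unique[OF aff _ _ that])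
        (use eq h in \<open>simp_all only: size flip: sum_mset_eq_sum_count[OF fin(1) multisets_of_size_subset]\<close>)
    moreover have "count M v = count M' v" if "v \<notin> V" for v
      using h that by (metis count_eq_zero_iff multisets_of_size_subset subsetD)
    ultimately show "M = M'" by (auto simp: multiset_eq_iff)
  qed
  have disj: "f ` ?Q1 \<inter> \<Sum>\<^sub># ` ?Q2 = {}"
  proof (rule ccontr)
    assume "f ` ?Q1 \<inter> \<Sum>\<^sub># ` ?Q2 \<noteq> {}"
    then obtain a M M' where h: "a \<in> P" "M \<in> multisets_of_size V k"
        "M' \<in> multisets_of_size V (k + 1)" and eq: "f (a, M) = \<Sum>\<^sub># M'" by blast
    have M': "\<Sum>\<^sub># M' = (\<Sum>v\<in>V. real (count M' v) *\<^sub>R v)"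
      using sum_mset_eq_sum_count[OF fin(1) multisets_of_size_subset[OF h(3)]] .
    \<comment> \<open>The summand 0 is the fractional part to which \<open>frac\<close> compares
      \<open>\<alpha> a v\<close>. All coordinates of \<open>a\<close> then vanish, although their
      total is 1.\<close>
    have c: "\<alpha> a v + real (count M v) = 0 + real (count M' v)" if "v \<in> V" for v
      by (rule affine_independent_coeffs_unique[OF aff _ _ that])
        (use eq in \<open>simp_all add: f_eq[OF h(1,2)] M' sum.distrib \<alpha>(2)[OF h(1)] size[OF h(2)]
          size[OF h(3)] scaleR_left_distrib\<close>)
    have "\<alpha> a v = 0" if "v \<in> V" for v
      using frac(1)[OF c[OF that]] \<alpha>(1) \<alpha>1 h that by auto
    then show False using \<alpha>(2)[OF h(1)] by simp
  qed
  have sub1: "f ` ?Q1 \<subseteq> ?X"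
  proof (rule image_subsetI)
    fix p assume "p \<in> ?Q1"
    then obtain a M where p: "p = (a, M)" and h: "a \<in> P" "M \<in> multisets_of_size V k"
      by blast
    have "\<Sum>\<^sub># M \<in> (\<Sum>i=1..k. B)"
      using sum_mset_in_sumset[of M B] h(2) \<open>V \<subseteq> B\<close> by (auto simp: multisets_of_size_def)
    then have "f (a, M) \<in> A + (\<Sum>i=1..k. B)"
      using h(1) P(1) by (auto simp: f_def intro!: set_plus_intro)
    moreover have "\<alpha> a j + real (count M j) \<noteq> 0" if "j \<in> J" for j
      using \<alpha>J[OF h(1) that] \<alpha>(1)[OF h(1), of j] that \<open>J \<subseteq> V\<close> by (simp add: subset_iff add_nonneg_eq_0_iff)
    ultimately show "f p \<in> ?X"
      unfolding p f_eq[OF h]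
      by (intro memX) (use \<alpha>[OF h(1)] size[OF h(2)] in \<open>auto simp: sum.distrib\<close>)
  qed
  have sub2: "\<Sum>\<^sub># ` ?Q2 \<subseteq> ?X"
  proof (rule image_subsetI)
    fix M assume "M \<in> ?Q2"
    then have h: "M \<in> multisets_of_size V (k + 1)" "J \<subseteq> set_mset M" by blast+
    from h(1) have "M \<noteq> {#}" by (auto simp: multisets_of_size_def)
    \<comment> \<open>One of the \<open>k + 1\<close> vertices is used as the summand from
      \<open>A\<close>, the other \<open>k\<close> as those from \<open>B\<close>.\<close>
    then obtain x N where M: "M = add_mset x N" by (meson multiset_cases)
    have "\<Sum>\<^sub># N \<in> (\<Sum>i=1..k. B)"
      using sum_mset_in_sumset[of N B] h(1) \<open>V \<subseteq> B\<close> by (auto simp: multisets_of_size_def M)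
    moreover have "x \<in> A" using h(1) \<open>V \<subseteq> B\<close> \<open>B \<subseteq> A\<close> by (auto simp: multisets_of_size_def M)
    ultimately have "\<Sum>\<^sub># M \<in> A + (\<Sum>i=1..k. B)"
      by (auto simp: M intro!: set_plus_intro)
    then show "\<Sum>\<^sub># M \<in> ?X"
      unfolding sum_mset_eq_sum_count[OF fin(1) multisets_of_size_subset[OF h(1)]]
      by (intro memX) (use size[OF h(1)] h(2) in auto)
  qed
  have cardQ2: "(if card J \<le> k + 1 then card (multisets_of_size V (k + 1 - card J)) else 0)
      \<le> card ?Q2"
  proof (cases "card J \<le> k + 1")
    case True
    have "card (multisets_of_size V (k + 1 - card J)) \<le> card ?Q2"
    \<comment> \<open>One copy of each element of \<open>J\<close> is forced; the remaining
      \<open>k + 1 - card J\<close> vertices are free.\<close>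
    proof (rule card_inj_on_le[of "\<lambda>M. M + mset_set J"])
      show "finite ?Q2" using finite_multisets_of_size[OF fin(1)] by simp
      show "inj_on (\<lambda>M. M + mset_set J) (multisets_of_size V (k + 1 - card J))"
        by (auto intro: inj_onI)
      show "(\<lambda>M. M + mset_set J) ` multisets_of_size V (k + 1 - card J) \<subseteq> ?Q2"
        using True \<open>J \<subseteq> V\<close> fin(2) by (auto simp: multisets_of_size_def)
    qed
    then show ?thesis using True by simp
  qed simp
  have finQ: "finite ?Q1" "finite ?Q2"
    using fin finite_multisets_of_size[OF fin(1)] by auto
  have "card ?Q1 + card ?Q2 = card (f ` ?Q1 \<union> \<Sum>\<^sub># ` ?Q2)"
    using finQ disj by (subst card_Un_disjoint) (auto simp only: card_image[OF inj1] card_image[OF inj2] finite_imageI)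
  also have "\<dots> \<le> card ?X"
    using sub1 sub2 finX by (intro card_mono) auto
  finally show ?thesis using cardQ2 by (simp add: card_cartesian_product)
qed

section \<open>Decomposition of the hull along a shelling\<close>

text \<open>Lower-dimensional simplices have empty interior and hence measure zero. The part of the
  interior of the hull missed by the closed set of full simplices is open and covered by finitely
  many of them, so it is empty; taking closures gives the whole hull.\<close>

lemma full_simplices_cover:
  fixes B :: "'a::euclidean_space set"
  assumes T: "triangulation_of B \<T>" and dim: "aff_dim (convex hull B) = int DIM('a)"
  shows "\<Union>(full_simplices \<T>) = convex hull B"
proof
  let ?C = "convex hull B" and ?U = "\<Union>(full_simplices \<T>)"
  have fin: "finite \<T>" and simp: "\<And>S. S \<in> \<T> \<Longrightarrow> \<exists>n. n simplex S" and un: "\<Union>\<T> = ?C"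
    using T by (auto simp: triangulation_of_def simplicial_complex_def)
  show "?U \<subseteq> ?C" using un by (auto simp: full_simplices_def)
  have closed: "closed ?U"
    using fin by (intro closed_Union) (auto simp: full_simplices_def intro: closed_simplex)
  have "negligible S" if S: "S \<in> \<T> - full_simplices \<T>" for S
  proof -
    obtain n where n: "n simplex S" using simp S by blast
    then have "aff_dim S \<noteq> int DIM('a)"
      using S aff_dim_simplex[OF n] by (auto simp: full_simplices_def)
    then show ?thesis
      using negligible_convex_interior[OF convex_simplex[OF n]] aff_dim_nonempty_interior[of S]
      by blast
  qed
  then have "negligible (\<Union>(\<T> - full_simplices \<T>))"
    using fin by (intro negligible_Union) auto
  moreover have "interior ?C - ?U \<subseteq> \<Union>(\<T> - full_simplices \<T>)"
    using un interior_subset[of ?C] by blast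
  ultimately have "negligible (interior ?C - ?U)" by (rule negligible_subset)
  then have "interior ?C - ?U = {}"
    using open_not_negligible[of "interior ?C - ?U"] closed by (blast intro: open_Diff)
  then have sub: "interior ?C \<subseteq> ?U" by blast
  have "rel_interior ?C \<noteq> {}"
    using dim by (auto simp: rel_interior_eq_empty)
  then have "interior ?C \<noteq> {}"
    using dim by (simp add: interior_rel_interior_gen)
  then have "?C \<subseteq> closure (interior ?C)"
    using convex_closure_interior[OF convex_convex_hull] closure_subset by blast
  also have "\<dots> \<subseteq> ?U" using sub closed by (rule closure_minimal)
  finally show "?C \<subseteq> ?U" .
qed

text \<open>By the shelling condition, whatever earlier simplices cover in \<open>Ss ! i\<close>
  lies in facets that they cover entirely. Removing the earlier simplices therefore amounts to
  removing the facets opposite to \<open>J\<close>.\<close>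

lemma shelling_simplex_obtains:
  fixes B :: "'a::euclidean_space set"
  assumes T: "triangulation_of B \<T>" and sh: "shelling \<T> Ss" and i: "i < length Ss"
  obtains V J where "\<not> affine_dependent V" "card V = DIM('a) + 1" "Ss ! i = convex hull V"
    "J \<subseteq> V" "card J = shelling_index Ss i" "V = B \<inter> Ss ! i"
    "Ss ! i - \<Union>(set (take i Ss)) = convex hull V - (\<Union>j\<in>J. convex hull (V - {j}))"
    "i \<noteq> 0 \<Longrightarrow> J \<noteq> {}"
proof -
  let ?prev = "\<Union>(set (take i Ss))"
  have ST: "Ss ! i \<in> \<T>" and "int DIM('a) simplex (Ss ! i)"
    using sh nth_mem[OF i] by (auto simp: shelling_def full_simplices_def)
  then obtain V where V: "\<not> affine_dependent V" "card V = DIM('a) + 1" "Ss ! i = convex hull V"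
    unfolding simplex_def by force
  have face: "\<And>F S. S \<in> \<T> \<Longrightarrow> F face_of S \<Longrightarrow> F \<in> \<T>"
    and Int: "\<And>S S'. S \<in> \<T> \<Longrightarrow> S' \<in> \<T> \<Longrightarrow> (S \<inter> S') face_of S" and B: "{v. {v} \<in> \<T>} = B"
    using T by (auto simp: triangulation_of_def simplicial_complex_def)
  have vert: "v \<in> V \<longleftrightarrow> {v} face_of (Ss ! i)" for v
    unfolding V(3) face_of_singleton
    using extreme_point_of_convex_hull_affine_independent[OF V(1)] by blast
  have "v \<in> V \<longleftrightarrow> v \<in> B \<inter> Ss ! i" for v
  proof
    assume "v \<in> V"
    then show "v \<in> B \<inter> Ss ! i"
      using face[OF ST] vert B V(3) hull_subset[of V convex] by auto
  next
    assume v: "v \<in> B \<inter> Ss ! i"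
    then have "{v} \<in> \<T>" "Ss ! i \<inter> {v} = {v}" using B by auto
    \<comment> \<open>Two simplices of the complex meet in a common face, so a point of
      \<open>B\<close> in \<open>Ss ! i\<close> is a vertex of it.\<close>
    then show "v \<in> V" using Int[OF ST, of "{v}"] vert by simp
  qed
  then have VB: "V = B \<inter> Ss ! i" by blast
  define J where "J = {v \<in> V. convex hull (V - {v}) \<subseteq> ?prev}"
  \<comment> \<open>Facets are nonempty by definition; here this holds because the dimension is
    positive and \<open>V\<close> has at least two elements.\<close>
  have ne: "convex hull (V - {v}) \<noteq> {}" for v
  proof -
    have "card V - card {v} \<le> card (V - {v})" by (rule diff_card_le_card_Diff) simp
    then have "card (V - {v}) \<noteq> 0" using V(2) DIM_positive[where 'a='a] by (simp del: DIM_positive)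
    then show ?thesis by (metis card.empty convex_hull_eq_empty)
  qed
  have facets: "{F. F facet_of Ss ! i \<and> F \<subseteq> ?prev} = (\<lambda>v. convex hull (V - {v})) ` J"
    unfolding V(3) J_def facet_of_convex_hull_affine_independent[OF V(1)] using ne by blast
  have notin: "v \<notin> convex hull (V - {v})" if "v \<in> V" for v
    using V(1) that convex_hull_subset_affine_hull[of "V - {v}"]
    unfolding affine_dependent_def by blast
  \<comment> \<open>A vertex lies on the facet opposite to any other vertex but not on its own, so
    counting facets is counting vertices.\<close>
  have "inj_on (\<lambda>v. convex hull (V - {v})) V"
  proof (rule inj_onI, rule ccontr)
    fix v w assume h: "v \<in> V" "w \<in> V" "convex hull (V - {v}) = convex hull (V - {w})" "v \<noteq> w"
    then have "v \<in> convex hull (V - {w})" by (intro hull_inc) auto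
    then show False using h(3) notin[OF h(1)] by simp
  qed
  then have "inj_on (\<lambda>v. convex hull (V - {v})) J"
    by (rule inj_on_subset) (auto simp: J_def)
  then have cardJ: "card J = shelling_index Ss i"
    unfolding shelling_index_def facets by (simp add: card_image)
  have J_sub: "(\<Union>j\<in>J. convex hull (V - {j})) \<subseteq> ?prev" by (auto simp: J_def)
  have ne_attach: "J \<noteq> {}" and attach: "Ss ! i \<inter> ?prev \<subseteq> (\<Union>j\<in>J. convex hull (V - {j}))" if "i \<noteq> 0"
  proof -
    have "\<exists>\<F>. \<F> \<noteq> {} \<and> (\<forall>F\<in>\<F>. F facet_of Ss ! i) \<and> Ss ! i \<inter> ?prev = \<Union>\<F>"
      by (rule conjunct2[OF conjunct2[OF sh[unfolded shelling_def]], rule_format])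
        (use i \<open>i \<noteq> 0\<close> in simp)
    then obtain \<F> where F: "\<F> \<noteq> {}" "\<forall>F\<in>\<F>. F facet_of Ss ! i" "Ss ! i \<inter> ?prev = \<Union>\<F>"
      by blast
    \<comment> \<open>Each facet in the union is part of the intersection with the earlier
      simplices, hence opposite to an element of \<open>J\<close>.\<close>
    have "\<F> \<subseteq> {F. F facet_of Ss ! i \<and> F \<subseteq> ?prev}" using F by blast
    then have "\<F> \<subseteq> (\<lambda>v. convex hull (V - {v})) ` J" unfolding facets .
    then show "J \<noteq> {}" "Ss ! i \<inter> ?prev \<subseteq> (\<Union>j\<in>J. convex hull (V - {j}))"
      unfolding F(3) using F(1) by blast+
  qed
  \<comment> \<open>For \<open>i = 0\<close> nothing precedes and the left side is empty.\<close>
  then have "Ss ! i \<inter> ?prev \<subseteq> (\<Union>j\<in>J. convex hull (V - {j}))"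
    by (cases "i = 0") auto
  then have D: "Ss ! i - ?prev = convex hull V - (\<Union>j\<in>J. convex hull (V - {j}))"
    using J_sub V(3) by blast
  have "J \<subseteq> V" by (auto simp: J_def)
  show thesis
    by (rule that[OF V \<open>J \<subseteq> V\<close> cardJ VB D]) (rule ne_attach)
qed

text \<open>The least position containing \<open>x\<close> works. With the uniqueness that follows,
  the pieces left after removing earlier simplices partition the union.\<close>

lemma mem_first_occurrence:
  assumes "x \<in> \<Union>(set Ss)"
  shows "\<exists>i<length Ss. x \<in> Ss ! i - \<Union>(set (take i Ss))"
proof -
  have ex: "\<exists>i. i < length Ss \<and> x \<in> Ss ! i" using assms by (auto simp: in_set_conv_nth)
  define i where "i = (LEAST i. i < length Ss \<and> x \<in> Ss ! i)"
  have i: "i < length Ss" "x \<in> Ss ! i" using LeastI_ex[OF ex] by (auto simp: i_def)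
  have "x \<notin> Ss ! j" if "j < i" for j
    using not_less_Least[of j "\<lambda>i. i < length Ss \<and> x \<in> Ss ! i"] that i unfolding i_def by linarith
  then show ?thesis using i by (force simp: in_set_conv_nth)
qed

lemma first_occurrence_unique:
  assumes "i < length Ss" "j < length Ss"
    "x \<in> Ss ! i - \<Union>(set (take i Ss))" "x \<in> Ss ! j - \<Union>(set (take j Ss))"
  shows "i = j"
proof -
  have "Ss ! a \<in> set (take b Ss)" if "a < b" "b < length Ss" for a b
    using that by (auto simp: in_set_conv_nth intro!: exI[of _ a])
  then show ?thesis
    using assms by (metis Diff_iff UnionI linorder_neqE_nat)
qed

text \<open>A vertex that first appears in a simplex lies on none of its facets but the opposite one,
  so it can only be added in a step of index 1, and each such step adds only one vertex.\<close>

lemma card_vertices_le_shelling_index_1: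
  fixes B :: "'a::euclidean_space set"
  assumes T: "triangulation_of B \<T>" and dim: "aff_dim (convex hull B) = int DIM('a)"
    and sh: "shelling \<T> Ss" and "finite B"
  shows "card B \<le> DIM('a) + 1 + card {i. i < length Ss \<and> shelling_index Ss i = 1}"
proof -
  let ?D = "\<lambda>i. Ss ! i - \<Union>(set (take i Ss))"
  let ?I = "{i. i < length Ss \<and> shelling_index Ss i = 1}"
  have cover: "\<Union>(set Ss) = convex hull B"
    using sh full_simplices_cover[OF T dim] by (simp add: shelling_def)
  then have "\<Union>(set Ss) \<noteq> {}" using dim by auto
  then have len: "0 < length Ss" by auto
  obtain V0 where V0: "card V0 = DIM('a) + 1" "V0 = B \<inter> Ss ! 0"
    by (rule shelling_simplex_obtains[OF T sh len]) blast
  have "\<forall>b\<in>B. \<exists>i<length Ss. b \<in> ?D i"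
  proof
    fix b assume "b \<in> B"
    then have "b \<in> \<Union>(set Ss)" unfolding cover by (rule hull_inc)
    then show "\<exists>i<length Ss. b \<in> ?D i" by (rule mem_first_occurrence)
  qed
  then obtain idx where idx: "\<And>b. b \<in> B \<Longrightarrow> idx b < length Ss" "\<And>b. b \<in> B \<Longrightarrow> b \<in> ?D (idx b)"
    by metis
  have new: "shelling_index Ss i = 1 \<and> b = c"
    if i: "i < length Ss" "i \<noteq> 0" and bc: "b \<in> B" "b \<in> ?D i" "c \<in> B" "c \<in> ?D i" for i b c
  proof -
    obtain V J where V: "J \<subseteq> V" "card J = shelling_index Ss i" "V = B \<inter> Ss ! i"
      "?D i = convex hull V - (\<Union>j\<in>J. convex hull (V - {j}))" "J \<noteq> {}"
      by (rule shelling_simplex_obtains[OF T sh i(1)]) (use i(2) in blast)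
    have only: "j = x" if "j \<in> J" "x \<in> B" "x \<in> ?D i" for j x
    proof (rule ccontr)
      assume "j \<noteq> x"
      then have "x \<in> convex hull (V - {j})" using that V(3) by (intro hull_inc) auto
      then show False using that V(4) by blast
    qed
    \<comment> \<open>\<open>J\<close> is nonempty since \<open>i\<close> is not the first position,
      and \<open>only\<close> identifies each of its elements with \<open>b\<close>, and likewise
      with \<open>c\<close>.\<close>
    then have "J = {b}" using V(5) bc by blast
    then show ?thesis using V(2) only bc by auto
  qed
  have idx0: "idx b \<noteq> 0" if "b \<in> B - V0" for b
    using idx(2)[of b] that V0(2) by auto
  \<comment> \<open>By \<open>new\<close>, vertices outside \<open>V0\<close> with the same first
    position coincide, and that position has index 1.\<close>
  have "card (B - V0) \<le> card ?I"
  proof (rule card_inj_on_le)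
    show "inj_on idx (B - V0)"
      using new idx idx0 by (intro inj_onI) (metis DiffD1)
    show "idx ` (B - V0) \<subseteq> ?I"
      using new idx idx0 by blast
  qed simp
  moreover have "card B \<le> card V0 + card (B - V0)"
    using V0(2) \<open>finite B\<close> by (metis card_Un_le Diff_partition Int_lower1)
  ultimately show ?thesis using V0(1) by linarith
qed

section \<open>Summation over the shelling\<close>

lemma shelling_index_0 [simp]:
  "shelling_index Ss 0 = 0"
proof -
  have "{F. F facet_of Ss ! 0 \<and> F \<subseteq> {}} = {}" by (auto simp: facet_of_def)
  then show ?thesis by (simp only: shelling_index_def take0 list.set Union_empty card.empty)
qed

text \<open>This evaluates the constant left by the terms for indices 0 and 1. It combines Pascal's
  rule with the absorption identity relating \<open>(d + k) choose (k + 1)\<close> to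
  \<open>(d + k) choose k\<close>.\<close>

lemma binomial_absorb_identity:
  "int ((d + k + 1) choose (k + 1)) - int (d + 1) * int ((d + k) choose k)
    = - (int k * int ((d + k) choose (k + 1)))"
proof -
  have "(k + 1) * ((d + k) choose (k + 1)) = d * ((d + k) choose k)"
  proof (cases d)
    case (Suc b)
    then have "d + k = Suc (k + b)" by simp
    then show ?thesis using Suc_times_binomial_add[of k b] Suc by (simp only: Suc_eq_plus1)
  qed simp
  then have "int (k + 1) * int ((d + k) choose (k + 1)) = int d * int ((d + k) choose k)"
    by (metis of_nat_mult)
  moreover have "(d + k + 1) choose (k + 1) = ((d + k) choose k) + ((d + k) choose (k + 1))"
    by simp
  ultimately show ?thesis by (simp add: algebra_simps)
qed

theorem theorem6p3:
  fixes A B :: "'a::euclidean_space set" and \<T> :: "'a set set"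
    and h :: "nat \<Rightarrow> nat" and d k :: nat
  assumes "d = DIM('a)"
    and "finite A" and "finite B"
    and "aff_dim (convex hull B) = int d"
    and "B \<subseteq> A" and "A \<subseteq> convex hull B"
    and "k \<ge> 1"
    and "triangulation_of B \<T>"
    and "shellable \<T>"
    and "is_h_vector \<T> h"
  shows "int (card (A + (\<Sum>i=1..k. B))) \<ge>
      int ((d + k) choose k) * int (card A) - int k * int ((d + k) choose (k + 1))
      + (\<Sum>j=2..min d (k + 1). int (h j) * int ((d + k + 1 - j) choose (k + 1 - j)))"
proof -
  note d = assms(1)
  have dim: "aff_dim (convex hull B) = int DIM('a)" using assms by simp
  have T: "triangulation_of B \<T>" by fact
  obtain Ss where sh: "shelling \<T> Ss"
    and h: "\<And>j. j \<le> d \<Longrightarrow> h j = card {i. i < length Ss \<and> shelling_index Ss i = j}"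
    using assms(10) unfolding is_h_vector_def d by blast
  define m where "m = length Ss"
  define s where "s = shelling_index Ss"
  define D where "D i = Ss ! i - \<Union>(set (take i Ss))" for i
  \<comment> \<open>The case distinction matters: for \<open>j > k + 1\<close> truncated subtraction
    would make the binomial coefficient 1, whereas no multiset of size \<open>k + 1\<close> contains
    \<open>j\<close> distinct vertices.\<close>
  define g where "g j = (if j \<le> k + 1 then (d + k + 1 - j) choose (k + 1 - j) else 0)" for j
  define X where "X = A + (\<Sum>i=1..k. B)"
  define P where "P i = {a \<in> A - B. a \<in> D i}" for i
  define Y where "Y i = {x \<in> X. x /\<^sub>R real (k + 1) \<in> D i}" for i
  have cover: "\<Union>(set Ss) = convex hull B"
    using sh full_simplices_cover[OF T dim] by (simp add: shelling_def)
  have D_disj: "i = j" if "i < m" "j < m" "x \<in> D i" "x \<in> D j" for i j x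
    using first_occurrence_unique[of i Ss j x] that by (simp add: D_def m_def)
  have finX: "finite X"
    unfolding X_def using finite_set_plus finite_sum_sets assms(2,3) by blast
  have piece: "card (P i) * ((d + k) choose k) + g (s i) \<le> card (Y i)" if i: "i < m" for i
  proof -
    obtain V J where V: "\<not> affine_dependent V" "card V = DIM('a) + 1" "Ss ! i = convex hull V"
      "J \<subseteq> V" "card J = shelling_index Ss i" "V = B \<inter> Ss ! i"
      "Ss ! i - \<Union>(set (take i Ss)) = convex hull V - (\<Union>j\<in>J. convex hull (V - {j}))"
      by (rule shelling_simplex_obtains[OF T sh i[unfolded m_def]]) (rule that; assumption)
    note V = V(1,4,6) V(2,5,7)[folded d s_def D_def]
    have "finite V" using V(1) aff_independent_finite by blast
    have "card (P i) * card (multisets_of_size V k) +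
        (if card J \<le> k + 1 then card (multisets_of_size V (k + 1 - card J)) else 0) \<le> card (Y i)"
      unfolding Y_def X_def V(6)
      by (rule simplex_piece_card_lower_bound[of V J B A "P i"])
        (use V(1-3) V(6)[symmetric] assms(2,5) in \<open>auto simp: P_def\<close>)
    \<comment> \<open>A set of \<open>d + 1\<close> vertices has \<open>(d + n) choose n\<close>
      multisets of size \<open>n\<close>; here \<open>n\<close> is \<open>k\<close> or
      \<open>k + 1 - card J\<close>.\<close>
    then show ?thesis
      unfolding card_multisets_of_size[OF \<open>finite V\<close>] V(4,5) g_def by (auto split: if_splits)
  qed
  have D_cover: "\<exists>i<m. a \<in> D i" if "a \<in> A" for a
    using mem_first_occurrence[of a Ss] cover assms(6) that unfolding D_def m_def by blast
  have AB: "A - B = (\<Union>i\<in>{..<m}. P i)"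
  proof
    show "A - B \<subseteq> (\<Union>i\<in>{..<m}. P i)" using D_cover by (force simp: P_def)
  qed (auto simp: P_def)
  have P_disj: "P i \<inter> P j = {}" and Y_disj: "Y i \<inter> Y j = {}" if "i < m" "j < m" "i \<noteq> j" for i j
    using D_disj[OF that(1,2)] that(3) unfolding P_def Y_def by blast+
  have cardP: "card (A - B) = (\<Sum>i<m. card (P i))"
    unfolding AB using P_disj assms(2) by (intro card_UN_disjoint) (auto simp: P_def)
  have "(\<Sum>i<m. card (Y i)) = card (\<Union>i<m. Y i)"
    using Y_disj finX by (intro card_UN_disjoint[symmetric]) (auto simp: Y_def)
  also have "\<dots> \<le> card X"
    using finX by (intro card_mono) (auto simp: Y_def)
  finally have "(\<Sum>i<m. card (P i) * ((d + k) choose k) + g (s i)) \<le> card X"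
    using sum_mono[of "{..<m}", OF piece] by force
  then have main: "card (A - B) * ((d + k) choose k) + (\<Sum>i<m. g (s i)) \<le> card X"
    unfolding cardP by (simp add: sum.distrib sum_distrib_right)
  \<comment> \<open>\<open>h\<close> is specified only up to \<open>d\<close>, and \<open>g\<close>
    vanishes above \<open>k + 1\<close>. Positions with an index outside \<open>?R\<close>
    contribute nonnegative terms, so dropping them preserves the lower bound.\<close>
  let ?R = "{..min d (k + 1)}"
  have "(\<Sum>j\<in>?R. h j * g j) = (\<Sum>j\<in>?R. \<Sum>i\<in>{i \<in> {i \<in> {..<m}. s i \<in> ?R}. s i = j}. g (s i))"
  proof (rule sum.cong)
    fix j assume j: "j \<in> ?R"
    then have "{i \<in> {i \<in> {..<m}. s i \<in> ?R}. s i = j} = {i. i < length Ss \<and> shelling_index Ss i = j}"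
      by (auto simp: m_def s_def)
    then show "h j * g j = (\<Sum>i\<in>{i \<in> {i \<in> {..<m}. s i \<in> ?R}. s i = j}. g (s i))"
      using h[of j] j by (simp add: s_def)
  qed simp
  also have "\<dots> = (\<Sum>i\<in>{i \<in> {..<m}. s i \<in> ?R}. g (s i))"
    by (rule sum.group) auto
  also have "\<dots> \<le> (\<Sum>i<m. g (s i))"
    by (rule sum_mono2) auto
  finally have hg: "(\<Sum>j\<in>?R. h j * g j) \<le> (\<Sum>i<m. g (s i))" .
  have "d \<ge> 1" using d DIM_positive[where 'a='a] by linarith
  then have "?R = {0} \<union> {1} \<union> {2..min d (k + 1)}" by auto
  then have split: "(\<Sum>j\<in>?R. h j * g j) = h 0 * g 0 + h 1 * g 1 + (\<Sum>j=2..min d (k + 1). h j * g j)"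
    by (simp add: sum.union_disjoint)
  \<comment> \<open>The hull is nonempty, so a first simplex exists; its index is 0, which gives
    \<open>h 0\<close> at least 1.\<close>
  have "m > 0" using cover dim by (auto simp: m_def)
  then have "{0} \<subseteq> {i. i < length Ss \<and> shelling_index Ss i = 0}" by (simp add: m_def)
  then have "card {0::nat} \<le> h 0" unfolding h[of 0, simplified] by (intro card_mono) auto
  then have h0: "g 0 \<le> h 0 * g 0" by simp
  have "card B \<le> d + 1 + h 1"
    using card_vertices_le_shelling_index_1[OF T dim sh assms(3)] h[OF \<open>d \<ge> 1\<close>] d by simp
  \<comment> \<open>The factor is \<open>g 1\<close>, which is also the number of translates
    contributed by each point of \<open>A - B\<close>.\<close>
  then have "int (card B) * int ((d + k) choose k) \<le> int (d + 1 + h 1) * int ((d + k) choose k)"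
    by (intro mult_right_mono) auto
  then have h1: "(int (card B) - int (d + 1)) * int ((d + k) choose k) \<le> int (h 1 * g 1)"
    by (simp add: g_def algebra_simps)
  have tail: "(\<Sum>j=2..min d (k + 1). int (h j) * int ((d + k + 1 - j) choose (k + 1 - j)))
      = int (\<Sum>j=2..min d (k + 1). h j * g j)"
    by (simp add: g_def)
  have "int (card (A - B)) = int (card A) - int (card B)"
    using assms(2,3,5) by (simp add: card_Diff_subset card_mono)
  moreover have "int (card (A - B)) * int ((d + k) choose k) + int (g 0) + int (h 1 * g 1)
      + int (\<Sum>j=2..min d (k + 1). h j * g j) \<le> int (card X)"
    using main hg split h0 by (simp only: of_nat_add[symmetric] of_nat_mult[symmetric] of_nat_le_iff)
  \<comment> \<open>The two terms in \<open>card B\<close> cancel, leaving \<open>card A\<close> and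
    a constant that depends only on \<open>d\<close> and \<open>k\<close>.\<close>
  ultimately have "(int (card A) - int (card B)) * int ((d + k) choose k)
      + int ((d + k + 1) choose (k + 1)) + (int (card B) - int (d + 1)) * int ((d + k) choose k)
      + int (\<Sum>j=2..min d (k + 1). h j * g j) \<le> int (card X)"
    using h1 by (simp add: g_def del: of_nat_sum of_nat_mult)
  then show ?thesis
    using binomial_absorb_identity[of d k] unfolding tail X_def[symmetric]
    by (simp add: algebra_simps del: of_nat_sum of_nat_mult of_nat_Suc binomial_Suc_Suc)
qed

end
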